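(* Let $x^{*}$ be an arbitrary sparsest solution (i.e. an optimal solution) of the problem $(P_0)$: $\min_{x\in R^n}\|x\|_0$ subject to $\|y-Ax\|_2\le\epsilon$, $Bx\le b$, and let $S$ be the support of $x^{*}$. Let $I$ and $\bar I$ be the index sets of the active and inactive constraints of $Bx\le b$ at $x^{*}$, and let $M^{*}=\begin{bmatrix}A_S\\ B_{I,S}\end{bmatrix}$. (a) The problem $(P_0)$ has infinitely many optimal solutions which have the same support as $x^{*}$ if the following condition holds: (C1) $\mathrm{Null}(M^{*})\ne\{0\}$ and $x^{*}$ does not admit the maximum cardinality of active constraints, i.e. $|I(x^{*})|\ne\max\{|I(z)|:z\in\Lambda\}$, where $\Lambda$ is the set of all optimal solutions of $(P_0)$. (b) If the error vector $e^{*}=y-Ax^{*}$ satisfies $\|e^{*}\|_2<\epsilon$, then $(P_0)$ has infinitely many optimal solutions which have the same support as $x^{*}$ if one of the following conditions holds: (C2) $\mathrm{Null}(M^{*})=\{0\}$ and $\mathrm{Null}(B_S)\ne\{0\}$. (C3) $\mathrm{Null}(M^{*})=\{0\}$ and $\{d: B_{I,S}d>0\}\cap\mathrm{Null}(B_{\bar I,S})\ne\emptyset$. (C4) $\mathrm{Null}(M^{*})=\{0\}$ and $\{d: B_{I,S}d<0\}\cap\mathrm{Null}(B_{\bar I,S})\ne\emptyset$.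
   Context: Data: $A\in R^{m\times n}$, $B\in R^{l\times n}$ with $m\ll n$ (in particular $m<n$) and $l\le n$; $y\in R^m$, $b\in R^l$ are given vectors and $\epsilon\ge 0$ is a given parameter. $\|x\|_0$ is the number of nonzero components of $x$; $\|\cdot\|_2$ is the Euclidean norm; vector inequalities ($\le$, $<$, $>$) are understood componentwise. The feasible set is $T=\{x:\|y-Ax\|_2\le\epsilon,\ Bx\le b\}$. If $k$ is the optimal value of $(P_0)$, then $\Lambda=\{x\in R^n:\|x\|_0=k,\ x\in T\}$. The support of $x$ is $\mathrm{supp}(x)=\{i:x_i\neq0\}$. For feasible $x$, $I(x)=\{j\in\{1,\dots,l\}:(Bx)_j=b_j\}$ and $|I(x)|$ is its cardinality; $I=I(x^{*})$ and $\bar I=\{1,\dots,l\}\setminus I$. For an index set $S$ of columns, $A_S$, $B_S$ are the submatrices of $A$, $B$ consisting of the columns indexed by $S$; for an index set $J$ of rows, $B_{J,S}$ is the submatrix of $B$ with rows indexed by $J$ and columns indexed by $S$. $\mathrm{Null}(\cdot)$ denotes the null space. Vectors $d$ range over $R^{|S|}$.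
   Formalization: Conditions (C3) and (C4) additionally require the support S of x* to be nonempty: if x* = 0 and no constraint is active (e.g. y = 0, ε = 1, b > 0), they hold vacuously, yet 0 is the only vector with empty support. *)

theory Defs
  imports "HOL-Analysis.L2_Norm" "Jordan_Normal_Form.Matrix_Kernel"
    "Jordan_Normal_Form.DL_Submatrix"
begin

text \<open>Rows, columns and components are indexed from 0.  For an index set \<open>J\<close> of rows and an index
  set \<open>S\<close> of columns, \<open>submatrix B J S\<close> is $B_{J,S}$, with its rows and columns renumbered in
  increasing order, and \<open>submatrix A UNIV S\<close> is $A_S$.  Its kernel \<open>mat_kernel\<close> is thus a set of
  vectors of dimension \<open>card S\<close>; the trivial kernel is \<open>{0\<^sub>v (card S)}\<close>.\<close>

definition supp_vec :: "real vec \<Rightarrow> nat set" where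
  "supp_vec x = {i. i < dim_vec x \<and> x $ i \<noteq> 0}"

definition l0_norm :: "real vec \<Rightarrow> nat" where
  "l0_norm x = card (supp_vec x)"

definition l2_norm :: "real vec \<Rightarrow> real" where
  "l2_norm v = L2_set (($) v) {..<dim_vec v}"

text \<open>The order \<open>\<le>\<close> on \<open>vec\<close> is componentwise, but \<open>v < w\<close> there only means
  \<open>v \<le> w \<and> v \<noteq> w\<close>.  The relation below is strict in every component.\<close>

definition vec_less :: "real vec \<Rightarrow> real vec \<Rightarrow> bool" (infix "<\<^sub>v" 50) where
  "v <\<^sub>v w \<longleftrightarrow> dim_vec v = dim_vec w \<and> (\<forall>i < dim_vec w. v $ i < w $ i)"

definition feasible_set ::
  "real mat \<Rightarrow> real vec \<Rightarrow> real mat \<Rightarrow> real vec \<Rightarrow> real \<Rightarrow> real vec set" where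
  "feasible_set A y B b \<epsilon> =
     {x \<in> carrier_vec (dim_col A). l2_norm (y - A *\<^sub>v x) \<le> \<epsilon> \<and> B *\<^sub>v x \<le> b}"

text \<open>\<open>Inf\<close> on \<open>nat\<close> is the least element of a nonempty set, so the optimal value is attained
  whenever the problem is feasible.  For an infeasible problem its value is irrelevant:
  \<open>sparsest_solutions\<close> is then empty.\<close>

definition optimal_value ::
  "real mat \<Rightarrow> real vec \<Rightarrow> real mat \<Rightarrow> real vec \<Rightarrow> real \<Rightarrow> nat" where
  "optimal_value A y B b \<epsilon> = Inf (l0_norm ` feasible_set A y B b \<epsilon>)"

definition sparsest_solutions ::
  "real mat \<Rightarrow> real vec \<Rightarrow> real mat \<Rightarrow> real vec \<Rightarrow> real \<Rightarrow> real vec set" where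
  "sparsest_solutions A y B b \<epsilon> =
     {x \<in> feasible_set A y B b \<epsilon>. l0_norm x = optimal_value A y B b \<epsilon>}"

lemma sparsest_solutions_iff_is_arg_min:
  "x \<in> sparsest_solutions A y B b \<epsilon> \<longleftrightarrow>
     is_arg_min l0_norm (\<lambda>z. z \<in> feasible_set A y B b \<epsilon>) x"
proof -
  let ?T = "feasible_set A y B b \<epsilon>"
  have "Inf (l0_norm ` ?T) \<in> l0_norm ` ?T" if "z \<in> ?T" for z
    using that by (intro Inf_nat_def1) auto
  moreover have "Inf (l0_norm ` ?T) \<le> l0_norm z" if "z \<in> ?T" for z
    using that by (intro cInf_lower) auto
  ultimately show ?thesis
    unfolding sparsest_solutions_def optimal_value_def is_arg_min_linorder mem_Collect_eq
    by (metis imageE le_antisym)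
qed

definition active_set :: "real mat \<Rightarrow> real vec \<Rightarrow> real vec \<Rightarrow> nat set" where
  "active_set B b x = {j. j < dim_row B \<and> (B *\<^sub>v x) $ j = b $ j}"

end

theory Submission
  imports Defs
begin

text \<open>Optimality in (P0) is stable along suitable rays. Take a nonzero \<open>D\<close>
  supported in \<open>S\<close> that does not increase any active constraint, and suppose either
  \<open>A\<close> kills \<open>D\<close> or the residual bound is strict at \<open>xs\<close>. For
  all small t > 0 the point xs + t D is feasible: active constraints do not grow, inactive ones have
  slack, and the residual is either constant or continuous in t. It has the support
  \<open>S\<close>, since nonzero entries survive small changes and \<open>D\<close> adds no new
  ones. Hence it has the same l0 value and is again optimal, and distinct t give distinct points.
  This is \<open>infinite_sparsest_solutions_if_direction\<close>.

  Each condition then only has to supply \<open>D\<close>, obtained by padding a vector indexed by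
  \<open>S\<close> with zeros; \<open>submatrix_mult_vec_index\<close> carries kernel and sign
  conditions over to the full matrices. For C1 it is a kernel vector of \<open>M\<close> (no
  residual slack is required), for C2 a kernel vector of \<open>B\<close> restricted to
  \<open>S\<close>, for C4 the given \<open>d\<close>, for C3 its negative. If no constraint is
  active, a unit vector at an index in \<open>S\<close> serves for C3 and C4.\<close>

section \<open>Padding vectors indexed by a support with zeros\<close>

text \<open>Undoes the renumbering made by \<open>submatrix\<close>:
  \<open>card {a \<in> S. a < i}\<close> is the position of \<open>i\<close> in the increasing
  enumeration \<open>pick S\<close>.\<close>

definition extend_vec :: "nat \<Rightarrow> nat set \<Rightarrow> 'a :: zero vec \<Rightarrow> 'a vec" where
  "extend_vec n S d = vec n (\<lambda>i. if i \<in> S then d $ card {a \<in> S. a < i} else 0)"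

lemma extend_vec_carrier [simp]: "extend_vec n S d \<in> carrier_vec n"
  by (simp add: extend_vec_def)

lemma extend_vec_index:
  "i < n \<Longrightarrow> extend_vec n S d $ i = (if i \<in> S then d $ card {a \<in> S. a < i} else 0)"
  by (simp add: extend_vec_def)

lemma supp_extend_vec: "supp_vec (extend_vec n S d) \<subseteq> S"
  by (auto simp: supp_vec_def extend_vec_def split: if_splits)

lemma card_less_in_set_less:
  fixes i :: nat
  assumes "finite S" "i \<in> S"
  shows "card {a \<in> S. a < i} < card S"
  using assms by (intro psubset_card_mono) auto

lemma extend_vec_index_pick:
  assumes "S \<subseteq> {..<n}" "k < card S"
  shows "extend_vec n S d $ pick S k = d $ k"
  using pick_in_set_le[OF assms(2)] card_pick_le[OF assms(2)] assms(1)
  by (auto simp: extend_vec_index)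

text \<open>Padding loses no entry: the one at \<open>k\<close> reappears at
  \<open>pick S k\<close>.\<close>

lemma extend_vec_nonzero:
  assumes "S \<subseteq> {..<n}" "d \<in> carrier_vec (card S)" "d \<noteq> 0\<^sub>v (card S)"
  shows "extend_vec n S d \<noteq> 0\<^sub>v n"
proof -
  obtain k where k: "k < card S" "d $ k \<noteq> 0"
    using assms(2,3) by (metis carrier_vecD dim_vec eq_vecI index_zero_vec)
  have "pick S k < n"
    using pick_in_set_le[OF k(1)] assms(1) by blast
  then show ?thesis
    using extend_vec_index_pick[OF assms(1) k(1), of d] k(2) by auto
qed

lemma submatrix_carrier:
  assumes "C \<in> carrier_mat r n" "J \<subseteq> {..<r}" "S \<subseteq> {..<n}"
  shows "submatrix C J S \<in> carrier_mat (card J) (card S)"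
proof -
  have "{i. i < r \<and> i \<in> J} = J" "{i. i < n \<and> i \<in> S} = S" using assms by auto
  then show ?thesis using assms by (auto simp: dim_submatrix)
qed

text \<open>The padded vector annihilates every column outside \<open>S\<close>, so the full product
  is already a sum over \<open>S\<close>; only the renumbering of rows and columns remains.\<close>

lemma submatrix_mult_vec_index:
  assumes C: "C \<in> carrier_mat r n" and J: "J \<subseteq> {..<r}" and S: "S \<subseteq> {..<n}"
    and d: "d \<in> carrier_vec (card S)" and i: "i \<in> J"
  shows "(submatrix C J S *\<^sub>v d) $ card {a \<in> J. a < i} = (C *\<^sub>v extend_vec n S d) $ i"
proof -
  let ?k = "card {a \<in> J. a < i}"
  have fin: "finite S" "finite J" using S J finite_subset by blast+
  have k: "?k < card J" using card_less_in_set_less[OF fin(2) i] .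
  have eq: "{i. i < r \<and> i \<in> J} = J" "{i. i < n \<and> i \<in> S} = S" using J S by auto
  have "(C *\<^sub>v extend_vec n S d) $ i = (\<Sum>j<n. C $$ (i, j) * extend_vec n S d $ j)"
    using C i J by (auto simp: scalar_prod_def extend_vec_def lessThan_atLeast0 intro!: sum.cong)
  also have "\<dots> = (\<Sum>j\<in>S. C $$ (i, j) * d $ card {a \<in> S. a < j})"
    using S by (intro sum.mono_neutral_cong_right) (auto simp: extend_vec_index)
  \<comment> \<open>\<open>pick S\<close> and the rank function are mutually inverse bijections
    between \<open>{..<card S}\<close> and \<open>S\<close>.\<close>
  also have "\<dots> = (\<Sum>q<card S. C $$ (i, pick S q) * d $ q)"
    using fin(1)
    by (intro sum.reindex_bij_witness[where i = "pick S" and j = "\<lambda>j. card {a \<in> S. a < j}"])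
      (auto simp: pick_in_set_le card_pick_le pick_card_in_set card_less_in_set_less)
  also have "\<dots> = (\<Sum>q<card S. submatrix C J S $$ (?k, q) * d $ q)"
    using C k eq by (intro sum.cong) (auto simp: submatrix_index pick_card_in_set[OF i])
  also have "\<dots> = (submatrix C J S *\<^sub>v d) $ ?k"
    using submatrix_carrier[OF C J S] d k
    by (auto simp: scalar_prod_def lessThan_atLeast0 intro!: sum.cong)
  finally show ?thesis by simp
qed

lemma mult_extend_vec_eq_0_if_submatrix:
  assumes "C \<in> carrier_mat r n" "J \<subseteq> {..<r}" "S \<subseteq> {..<n}" "d \<in> carrier_vec (card S)"
    and "submatrix C J S *\<^sub>v d = 0\<^sub>v (card J)" "i \<in> J"
  shows "(C *\<^sub>v extend_vec n S d) $ i = 0"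
  using submatrix_mult_vec_index[OF assms(1-4,6)] card_less_in_set_less[of J i] assms(5,6)
    finite_subset[OF assms(2)] by simp

lemma mat_kernel_nontrivialE:
  assumes "N \<in> carrier_mat r c" "mat_kernel N \<noteq> {0\<^sub>v c}"
  obtains d where "d \<in> carrier_vec c" "N *\<^sub>v d = 0\<^sub>v r" "d \<noteq> 0\<^sub>v c"
proof -
  have "0\<^sub>v c \<in> mat_kernel N" using assms(1) by (intro mat_kernelI) auto
  then obtain d where "d \<in> mat_kernel N" "d \<noteq> 0\<^sub>v c" using assms(2) by blast
  then show thesis using mat_kernelD[OF assms(1)] that by blast
qed

section \<open>Moving from a sparsest solution along a direction\<close>

lemma mult_mat_vec_add_smult_index:
  fixes C :: "'a :: field mat"
  assumes "C \<in> carrier_mat r n" "x \<in> carrier_vec n" "D \<in> carrier_vec n" "i < r"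
  shows "(C *\<^sub>v (x + t \<cdot>\<^sub>v D)) $ i = (C *\<^sub>v x) $ i + t * (C *\<^sub>v D) $ i"
proof -
  have "C *\<^sub>v (x + t \<cdot>\<^sub>v D) = C *\<^sub>v x + t \<cdot>\<^sub>v (C *\<^sub>v D)"
    using assms mult_mat_vec[OF assms(1,3)] by (simp add: mult_add_distrib_mat_vec)
  then show ?thesis using assms by simp
qed

lemma tendsto_l2_norm_residual:
  assumes A: "A \<in> carrier_mat m n" and y: "y \<in> carrier_vec m"
    and x: "x \<in> carrier_vec n" and D: "D \<in> carrier_vec n"
  shows "((\<lambda>t. l2_norm (y - A *\<^sub>v (x + t \<cdot>\<^sub>v D))) \<longlongrightarrow> l2_norm (y - A *\<^sub>v x)) (at_right 0)"
proof -
  have eq: "l2_norm (y - A *\<^sub>v (x + t \<cdot>\<^sub>v D))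
      = L2_set (\<lambda>i. y $ i - ((A *\<^sub>v x) $ i + t * (A *\<^sub>v D) $ i)) {..<m}" for t
    unfolding l2_norm_def
    using A y mult_mat_vec_add_smult_index[OF A x D, of _ t] by (intro L2_set_cong) auto
  \<comment> \<open>The vacuous summand with factor 0 gives the limit the exact shape that
    \<open>tendsto_intros\<close> produces.\<close>
  have eq0: "l2_norm (y - A *\<^sub>v x) = L2_set (\<lambda>i. y $ i - ((A *\<^sub>v x) $ i + 0 * (A *\<^sub>v D) $ i)) {..<m}"
    unfolding l2_norm_def using A y by (intro L2_set_cong) auto
  show ?thesis unfolding eq eq0 L2_set_def by (intro tendsto_intros)
qed

text \<open>If \<open>A D = 0\<close> the residual does not change along \<open>D\<close>; otherwise the strict inequality
  for the residual leaves room to move.  Inactive constraints survive small steps for the same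
  reason.\<close>

lemma infinite_sparsest_solutions_if_direction:
  assumes A: "A \<in> carrier_mat m n" and B: "B \<in> carrier_mat l n"
    and y: "y \<in> carrier_vec m" and b: "b \<in> carrier_vec l"
    and xs: "xs \<in> sparsest_solutions A y B b \<epsilon>"
    and D: "D \<in> carrier_vec n" "D \<noteq> 0\<^sub>v n" "supp_vec D \<subseteq> supp_vec xs"
    and AD: "A *\<^sub>v D = 0\<^sub>v m \<or> l2_norm (y - A *\<^sub>v xs) < \<epsilon>"
    and BD: "\<And>j. j \<in> active_set B b xs \<Longrightarrow> (B *\<^sub>v D) $ j \<le> 0"
  shows "infinite {x \<in> sparsest_solutions A y B b \<epsilon>. supp_vec x = supp_vec xs}"
    (is "infinite ?X")
proof -
  have xs_carr: "xs \<in> carrier_vec n" and res: "l2_norm (y - A *\<^sub>v xs) \<le> \<epsilon>"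
    and Bxs: "j < l \<Longrightarrow> (B *\<^sub>v xs) $ j \<le> b $ j" for j
    using xs A B b by (auto simp: sparsest_solutions_def feasible_set_def less_eq_vec_def)
  \<comment> \<open>The ray is followed for t > 0 only: an active constraint may strictly decrease
    along \<open>D\<close>, and a negative t would then violate it.\<close>
  define p where "p t = xs + t \<cdot>\<^sub>v D" for t
  have p_carr: "p t \<in> carrier_vec n" for t using xs_carr D(1) by (simp add: p_def)
  have p_index: "p t $ i = xs $ i + t * D $ i" if "i < n" for i t
    using that D(1) xs_carr by (simp add: p_def)
  obtain i0 where i0: "i0 < n" "D $ i0 \<noteq> 0"
    using D(1,2) by (metis carrier_vecD dim_vec eq_vecI index_zero_vec)

  have "\<forall>\<^sub>F t in at_right 0. p t $ i \<noteq> 0" if "i \<in> supp_vec xs" for i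
  proof -
    have i: "i < n" "xs $ i \<noteq> 0" using that xs_carr by (auto simp: supp_vec_def)
    have "((\<lambda>t. xs $ i + t * D $ i) \<longlongrightarrow> xs $ i + 0 * D $ i) (at_right 0)"
      by (intro tendsto_intros)
    then show ?thesis using i by (simp add: p_index tendsto_imp_eventually_ne)
  qed
  then have ev_supp: "\<forall>\<^sub>F t in at_right 0. \<forall>i\<in>supp_vec xs. p t $ i \<noteq> 0"
    by (intro eventually_ball_finite) (auto simp: supp_vec_def)

  have "\<forall>\<^sub>F t in at_right 0. (B *\<^sub>v p t) $ j \<le> b $ j" if j: "j < l" for j
  proof -
    have eq: "(B *\<^sub>v p t) $ j = (B *\<^sub>v xs) $ j + t * (B *\<^sub>v D) $ j" for t
      unfolding p_def by (rule mult_mat_vec_add_smult_index[OF B xs_carr D(1) j])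
    show ?thesis
    proof (cases "j \<in> active_set B b xs")
      case True
      have "(B *\<^sub>v p t) $ j \<le> b $ j" if "t > 0" for t
        unfolding eq using BD[OF True] Bxs[OF j] that
        by (smt (verit) mult_nonneg_nonpos)
      then show ?thesis by (auto simp: eventually_at_filter)
    next
      case False
      then have lt: "(B *\<^sub>v xs) $ j < b $ j"
        using Bxs[OF j] j B by (auto simp: active_set_def)
      have "((\<lambda>t. (B *\<^sub>v xs) $ j + t * (B *\<^sub>v D) $ j)
          \<longlongrightarrow> (B *\<^sub>v xs) $ j + 0 * (B *\<^sub>v D) $ j) (at_right 0)"
        by (intro tendsto_intros)
      then have "\<forall>\<^sub>F t in at_right 0. (B *\<^sub>v p t) $ j < b $ j"
        unfolding eq using lt by (intro order_tendstoD(2)) auto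
      then show ?thesis by (rule eventually_mono) simp
    qed
  qed
  then have "\<forall>\<^sub>F t in at_right 0. \<forall>j\<in>{..<l}. (B *\<^sub>v p t) $ j \<le> b $ j"
    by (intro eventually_ball_finite) auto
  moreover have "\<forall>\<^sub>F t in at_right 0. l2_norm (y - A *\<^sub>v p t) \<le> \<epsilon>"
    using AD
  proof
    assume 0: "A *\<^sub>v D = 0\<^sub>v m"
    have "A *\<^sub>v p t = A *\<^sub>v xs" for t
      unfolding p_def using A xs_carr D(1) 0 mult_mat_vec[OF A D(1)]
      by (auto simp: mult_add_distrib_mat_vec intro!: eq_vecI)
    then show ?thesis using res by simp
  next
    assume "l2_norm (y - A *\<^sub>v xs) < \<epsilon>"
    from order_tendstoD(2)[OF tendsto_l2_norm_residual[OF A y xs_carr D(1)] this]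
    show ?thesis unfolding p_def by (rule eventually_mono) simp
  qed
  ultimately have "\<forall>\<^sub>F t in at_right 0. p t \<in> ?X"
    using ev_supp
  proof eventually_elim
    case (elim t)
    \<comment> \<open>Entries in the support of \<open>xs\<close> stay nonzero by
      \<open>ev_supp\<close>; outside it both \<open>xs\<close> and \<open>D\<close> vanish. Equal
      supports give equal \<open>l0_norm\<close>, so feasibility suffices for optimality.\<close>
    have "supp_vec (p t) = supp_vec xs"
      using elim(3) D(1,3) xs_carr p_carr[of t] p_index[of _ t]
      by (fastforce simp: supp_vec_def)
    moreover have "p t \<in> feasible_set A y B b \<epsilon>"
      using elim(1,2) A B b p_carr[of t] by (auto simp: feasible_set_def less_eq_vec_def)
    ultimately show ?case using xs by (auto simp: sparsest_solutions_def l0_norm_def)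
  qed
  then obtain \<delta> where \<delta>: "\<delta> > 0" "\<And>t. 0 < t \<Longrightarrow> t < \<delta> \<Longrightarrow> p t \<in> ?X"
    unfolding eventually_at_right_field by auto
  \<comment> \<open>The coordinate \<open>i0\<close>, where \<open>D\<close> is nonzero, determines
    t.\<close>
  have "inj_on p {0<..<\<delta>}"
  proof (rule inj_onI)
    fix s t assume "p s = p t"
    then have "xs $ i0 + s * D $ i0 = xs $ i0 + t * D $ i0" using p_index[OF i0(1)] by metis
    then show "s = t" using i0(2) by simp
  qed
  then have "infinite (p ` {0<..<\<delta>})"
    using \<delta>(1) by (simp add: finite_image_iff)
  moreover have "p ` {0<..<\<delta>} \<subseteq> ?X" using \<delta>(2) by auto
  ultimately show ?thesis using infinite_super by blast
qed

section \<open>Directions from the four conditions\<close>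

theorem theorem3p1:
  fixes m n l :: nat
    and A B M :: "real mat"
    and y b xs :: "real vec"
    and \<epsilon> :: real
    and S I I' :: "nat set"
    and \<Lambda> :: "real vec set"
  assumes "A \<in> carrier_mat m n" and "B \<in> carrier_mat l n"
    and "m < n" and "l \<le> n"
    and "y \<in> carrier_vec m" and "b \<in> carrier_vec l" and "\<epsilon> \<ge> 0"
    and "\<Lambda> = sparsest_solutions A y B b \<epsilon>"
    and "xs \<in> \<Lambda>"
    and "S = supp_vec xs"
    and "I = active_set B b xs"
    and "I' = {0..<l} - I"
    and "M = submatrix A UNIV S @\<^sub>r submatrix B I S"
  shows
    "(mat_kernel M \<noteq> {0\<^sub>v (card S)}
        \<and> card I \<noteq> Max {card (active_set B b z) | z. z \<in> \<Lambda>}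
      \<longrightarrow> infinite {x \<in> \<Lambda>. supp_vec x = S})
   \<and> (l2_norm (y - A *\<^sub>v xs) < \<epsilon>
      \<longrightarrow> (mat_kernel M = {0\<^sub>v (card S)}
            \<and> mat_kernel (submatrix B UNIV S) \<noteq> {0\<^sub>v (card S)})
        \<or> (mat_kernel M = {0\<^sub>v (card S)}
            \<and> {d \<in> carrier_vec (card S). 0\<^sub>v (card I) <\<^sub>v submatrix B I S *\<^sub>v d}
                \<inter> mat_kernel (submatrix B I' S) \<noteq> {}
            \<and> S \<noteq> {})
        \<or> (mat_kernel M = {0\<^sub>v (card S)}
            \<and> {d \<in> carrier_vec (card S). submatrix B I S *\<^sub>v d <\<^sub>v 0\<^sub>v (card I)}
                \<inter> mat_kernel (submatrix B I' S) \<noteq> {}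
            \<and> S \<noteq> {})
      \<longrightarrow> infinite {x \<in> \<Lambda>. supp_vec x = S})"
proof -
  note A = assms(1) and B = assms(2)
  have xs: "xs \<in> sparsest_solutions A y B b \<epsilon>" using assms(8,9) by simp
  then have xs_carr: "xs \<in> carrier_vec n"
    using A by (auto simp: sparsest_solutions_def feasible_set_def)
  have S: "S \<subseteq> {..<n}" using xs_carr assms(10) by (auto simp: supp_vec_def)
  have I: "I \<subseteq> {..<l}" using B assms(11) by (auto simp: active_set_def)
  have finI: "finite I" using I finite_subset by blast
  \<comment> \<open>The submatrix lemmas ask for row sets within the dimension, so
    \<open>UNIV\<close> is traded for the set of actual rows.\<close>
  have rows_UNIV: "submatrix C UNIV S = submatrix C {..<dim_row C} S" for C :: "real mat"
  proof -
    have "pick {..<dim_row C} i = i" if "i < dim_row C" for i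
      using pick_reduce_set[of i "dim_row C" UNIV] that by (simp add: pick_UNIV lessThan_def)
    then show ?thesis
      by (intro eq_matI) (simp_all add: dim_submatrix submatrix_index pick_UNIV)
  qed
  have sA: "submatrix A UNIV S \<in> carrier_mat m (card S)"
    unfolding rows_UNIV using submatrix_carrier[OF A _ S, of "{..<m}"] A by auto
  have sB: "submatrix B UNIV S \<in> carrier_mat l (card S)"
    unfolding rows_UNIV using submatrix_carrier[OF B _ S, of "{..<l}"] B by auto
  have sBI: "submatrix B I S \<in> carrier_mat (card I) (card S)"
    by (rule submatrix_carrier[OF B I S])

  have move: "infinite {x \<in> \<Lambda>. supp_vec x = S}"
    if "D \<in> carrier_vec n" "D \<noteq> 0\<^sub>v n" "supp_vec D \<subseteq> S"
      "A *\<^sub>v D = 0\<^sub>v m \<or> l2_norm (y - A *\<^sub>v xs) < \<epsilon>" "\<And>j. j \<in> I \<Longrightarrow> (B *\<^sub>v D) $ j \<le> 0" for D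
    using infinite_sparsest_solutions_if_direction[OF A B assms(5,6) xs, of D] that
      assms(8,10,11) by simp

  have C1: "infinite {x \<in> \<Lambda>. supp_vec x = S}" if "mat_kernel M \<noteq> {0\<^sub>v (card S)}"
  proof -
    have "M \<in> carrier_mat (m + card I) (card S)" using sA sBI assms(13) by auto
    then obtain d where d: "d \<in> carrier_vec (card S)" "M *\<^sub>v d = 0\<^sub>v (m + card I)"
        "d \<noteq> 0\<^sub>v (card S)"
      using \<open>mat_kernel M \<noteq> _\<close> by (rule mat_kernel_nontrivialE)
    \<comment> \<open>The two blocks of \<open>M\<close> are read off separately: the upper one
      keeps the residual constant, the lower one keeps the active constraints tight.\<close>
    have "(submatrix A UNIV S *\<^sub>v d) @\<^sub>v (submatrix B I S *\<^sub>v d) = 0\<^sub>v m @\<^sub>v 0\<^sub>v (card I)"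
      using d(2) mat_mult_append[OF sA sBI d(1)] assms(13) by (auto intro!: eq_vecI)
    then have AS0: "submatrix A UNIV S *\<^sub>v d = 0\<^sub>v m"
      and BI0: "submatrix B I S *\<^sub>v d = 0\<^sub>v (card I)"
      using append_vec_eq[OF mult_mat_vec_carrier[OF sA d(1)] zero_carrier_vec] by blast+
    from AS0 have "\<forall>i\<in>{..<m}. (A *\<^sub>v extend_vec n S d) $ i = 0"
      using mult_extend_vec_eq_0_if_submatrix[OF A _ S d(1), of "{..<m}"] A rows_UNIV[of A] by auto
    then have "A *\<^sub>v extend_vec n S d = 0\<^sub>v m" using A by (intro eq_vecI) auto
    moreover have "\<forall>j\<in>I. (B *\<^sub>v extend_vec n S d) $ j = 0"
      using mult_extend_vec_eq_0_if_submatrix[OF B I S d(1)] BI0 by auto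
    ultimately show ?thesis
      using extend_vec_nonzero[OF S d(1,3)] supp_extend_vec
      by (intro move[of "extend_vec n S d"]) auto
  qed

  have C2: "infinite {x \<in> \<Lambda>. supp_vec x = S}"
    if err: "l2_norm (y - A *\<^sub>v xs) < \<epsilon>" and ker: "mat_kernel (submatrix B UNIV S) \<noteq> {0\<^sub>v (card S)}"
  proof -
    obtain d where d: "d \<in> carrier_vec (card S)" "submatrix B UNIV S *\<^sub>v d = 0\<^sub>v l"
        "d \<noteq> 0\<^sub>v (card S)"
      using sB ker by (rule mat_kernel_nontrivialE)
    then have "\<forall>j\<in>{..<l}. (B *\<^sub>v extend_vec n S d) $ j = 0"
      using mult_extend_vec_eq_0_if_submatrix[OF B _ S d(1), of "{..<l}"] B rows_UNIV[of B] by auto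
    then show ?thesis
      using extend_vec_nonzero[OF S d(1,3)] supp_extend_vec err I
      by (intro move[of "extend_vec n S d"]) auto
  qed

  have C34: "infinite {x \<in> \<Lambda>. supp_vec x = S}"
    if err: "l2_norm (y - A *\<^sub>v xs) < \<epsilon>" and ne: "S \<noteq> {}" and d: "d \<in> carrier_vec (card S)"
      and less: "submatrix B I S *\<^sub>v d <\<^sub>v 0\<^sub>v (card I)" for d
  proof (cases "I = {}")
    case True
    \<comment> \<open>Here \<open>d\<close> may vanish, but every direction supported in \<open>S\<close> is admissible.\<close>
    obtain i where i: "i \<in> S" using ne by blast
    show ?thesis
    proof (rule move[of "unit_vec n i"])
      show "supp_vec (unit_vec n i) \<subseteq> S"
        using i S by (auto simp: supp_vec_def unit_vec_def split: if_splits)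
    qed (use i S err True in auto)
  next
    case False
    have neg: "(B *\<^sub>v extend_vec n S d) $ j < 0" if "j \<in> I" for j
      using less submatrix_mult_vec_index[OF B I S d that] card_less_in_set_less[OF finI that]
      by (auto simp: vec_less_def)
    obtain j where j: "j \<in> I" using False by blast
    \<comment> \<open>A strictly negative value of \<open>B\<close> at an active row
      \<open>j\<close> excludes the zero direction.\<close>
    have "extend_vec n S d \<noteq> 0\<^sub>v n"
    proof
      assume "extend_vec n S d = 0\<^sub>v n"
      then show False using neg[OF j] j I B by (auto simp: scalar_prod_def)
    qed
    then show ?thesis
      using neg supp_extend_vec err
      by (intro move[of "extend_vec n S d"]) (auto intro: less_imp_le)
  qed

  have C3: "infinite {x \<in> \<Lambda>. supp_vec x = S}"
    if err: "l2_norm (y - A *\<^sub>v xs) < \<epsilon>" and ne: "S \<noteq> {}" and d: "d \<in> carrier_vec (card S)"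
      and less: "0\<^sub>v (card I) <\<^sub>v submatrix B I S *\<^sub>v d" for d
  \<comment> \<open>Replacing \<open>d\<close> by its negative turns strictly positive active rows
    into strictly negative ones.\<close>
  proof (rule C34[OF err ne])
    show "- d \<in> carrier_vec (card S)" using d by simp
    show "submatrix B I S *\<^sub>v (- d) <\<^sub>v 0\<^sub>v (card I)"
      using less sBI d by (auto simp: vec_less_def)
  qed

  show ?thesis using C1 C2 C3 C34 by blast
qed

end
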